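(* Let $t=2t'+1$ be an odd positive integer. There is a bijection $\lambda\mapsto(v_0,v_1,\ldots,v_{t-1})$ from the set of $t$-cores onto the set of $V$-codings such that $$|\lambda|=\frac1{2t}\bigl(v_0^2+v_1^2+\cdots+v_{t-1}^2\bigr)-\frac{t^2-1}{24}$$ and $$\prod_{v\in\lambda}\Bigl(1-\frac{t^2}{h_v^2}\Bigr)=\frac{(-1)^{t'}}{1!\cdot2!\cdot3!\cdots(t-1)!}\prod_{0\le i<j\le t-1}(v_i-v_j).$$
   Context: A partition $\lambda$ is a weakly decreasing sequence of positive integers $\lambda_1\ge\cdots\ge\lambda_\ell$, with $|\lambda|=\sum\lambda_i$. Its boxes are the pairs $(i,j)$ with $1\le j\le\lambda_i$, and the hook length of $v=(i,j)$ is $h_v=\lambda_i-j+\lambda'_j-i+1$ with $\lambda'_j=\#\{k:\lambda_k\ge j\}$. A $t$-core is a partition none of whose hook lengths equals $t$. A $V$-coding is a vector $(v_0,\ldots,v_{t-1})\in\mathbb Z^t$ with $v_i\equiv i\pmod t$ for $0\le i\le t-1$ and $v_0+v_1+\cdots+v_{t-1}=0$. *)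

theory Defs
  imports Complex_Main "HOL-Number_Theory.Cong"
begin

text \<open>A partition is the list of its positive parts in weakly decreasing order.
  Parts, columns and boxes are numbered from 1, as usual for Young diagrams.\<close>

definition is_partition :: "nat list \<Rightarrow> bool" where
  "is_partition p \<longleftrightarrow> sorted_wrt (\<ge>) p \<and> (\<forall>x\<in>set p. x > 0)"

definition part :: "nat list \<Rightarrow> nat \<Rightarrow> nat" where
  "part p i = p ! (i - 1)"

definition conj_part :: "nat list \<Rightarrow> nat \<Rightarrow> nat" where
  "conj_part p j = card {k \<in> {1..length p}. part p k \<ge> j}"

definition boxes :: "nat list \<Rightarrow> (nat \<times> nat) set" where
  "boxes p = {(i, j). i \<in> {1..length p} \<and> j \<in> {1..part p i}}"

definition hook :: "nat list \<Rightarrow> nat \<times> nat \<Rightarrow> int" where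
  "hook p = (\<lambda>(i, j). int (part p i) - int j + int (conj_part p j) - int i + 1)"

definition t_cores :: "nat \<Rightarrow> nat list set" where
  "t_cores t = {p. is_partition p \<and> (\<forall>v\<in>boxes p. hook p v \<noteq> int t)}"

text \<open>Vectors in \<open>\<int>\<^sup>t\<close> are integer lists of length \<open>t\<close>.\<close>

definition V_codings :: "nat \<Rightarrow> int list set" where
  "V_codings t = {v. length v = t \<and> (\<forall>i<t. [v ! i = int i] (mod int t)) \<and> (\<Sum>i<t. v ! i) = 0}"

end

theory Submission
  imports Defs
begin

text \<open>Encode a partition by its bead set \<open>B = {\<lambda>\<^sub>i + \<ell> - i}\<close>. The boxes correspond to the pairs
  \<open>x \<in> B\<close>, \<open>y \<notin> B\<close>, \<open>y < x\<close>, with hook length \<open>x - y\<close>, so \<open>t\<close>-cores are the bead sets closed under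
  subtraction of \<open>t\<close>. Such a set is determined by the first gap \<open>w\<^sub>r\<close> on each residue class \<open>r\<close>, and
  the coding consists of the numbers \<open>w\<^sub>r - t' - \<ell>\<close>, indexed by their own residues.
  For the product formula, drop the condition on the sum and add beads one at a time: filling the
  gap \<open>w\<^sub>m\<close> multiplies the hook product by \<open>(w\<^sub>m + t - w\<^sub>r) / (w\<^sub>m - w\<^sub>r)\<close> for each \<open>r \<noteq> m\<close>, because
  \<open>1 - t\<^sup>2 / d\<^sup>2 = (d - t) (d + t) / d\<^sup>2\<close> telescopes along a residue class, and the Vandermonde product
  changes by the same factor.\<close>

section \<open>Partitions and their bead sets\<close>

text \<open>These are the beta-numbers of the partition, that is, the hook lengths of its first
  column.\<close>

primrec beads :: "nat list \<Rightarrow> nat list" where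
  "beads [] = []"
| "beads (a # p) = (a + length p) # beads p"

lemma length_beads [simp]: "length (beads p) = length p"
  by (induction p) auto

lemma nth_beads: "i < length p \<Longrightarrow> beads p ! i = p ! i + (length p - Suc i)"
  by (induction p arbitrary: i) (auto simp: nth_Cons split: nat.splits)

lemma beads_inj: "beads p = beads q \<Longrightarrow> p = q"
proof (induction p arbitrary: q)
  case Nil
  then show ?case by (metis length_beads length_0_conv)
next
  case (Cons a p)
  then obtain b q' where q: "q = b # q'" by (cases q) auto
  with Cons show ?case by auto
qed

lemma is_partition_Cons:
  "is_partition (a # p) \<longleftrightarrow> is_partition p \<and> a > 0 \<and> (\<forall>x\<in>set p. x \<le> a)"
  by (auto simp: is_partition_def)

lemma beads_less: "\<forall>x\<in>set p. x \<le> a \<Longrightarrow> b \<in> set (beads p) \<Longrightarrow> b < a + length p"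
  by (induction p) auto

lemma sorted_beads: "is_partition p \<Longrightarrow> sorted_wrt (>) (beads p)"
  by (induction p) (auto simp: is_partition_Cons beads_less)

lemma distinct_beads: "is_partition p \<Longrightarrow> distinct (beads p)"
  using sorted_beads[of p]
  by (auto simp: distinct_conv_nth sorted_wrt_iff_nth_less) (metis less_irrefl linorder_neqE_nat)

lemma card_beads: "is_partition p \<Longrightarrow> card (set (beads p)) = length p"
  by (simp add: distinct_beads distinct_card)

text \<open>Positivity of the parts turns into absence of the bead \<open>0\<close>; this is what
  fixes the number of beads, since padding by zero parts would create that bead.\<close>

lemma zero_notin_beads: "is_partition p \<Longrightarrow> 0 \<notin> set (beads p)"
  by (induction p) (auto simp: is_partition_Cons)

lemma beads_set_inj:
  assumes "is_partition p" "is_partition q" "set (beads p) = set (beads q)"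
  shows "p = q"
proof -
  have *: "sorted_wrt (<) (rev (beads p))" "sorted_wrt (<) (rev (beads q))"
    using assms sorted_beads by (auto simp: sorted_wrt_rev)
  then have "rev (beads p) = rev (beads q)"
    using assms(3) by (intro strict_sorted_equal) auto
  then show ?thesis by (simp add: beads_inj)
qed

text \<open>Adding the largest bead \<open>m\<close> prepends the part \<open>m - length q\<close>:
  it dominates the old parts because \<open>m\<close> exceeds the old top bead, and for empty
  \<open>q\<close> it is positive because \<open>m\<close> is not \<open>0\<close>.\<close>

lemma ex_partition_beads:
  "finite B \<Longrightarrow> 0 \<notin> B \<Longrightarrow> \<exists>p. is_partition p \<and> set (beads p) = B"
proof (induction B rule: finite_linorder_max_induct)
  case empty
  then show ?case by (intro exI[of _ "[]"]) (auto simp: is_partition_def)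
next
  case (insert m B)
  then obtain q where q: "is_partition q" "set (beads q) = B" by auto
  have "is_partition ((m - length q) # q) \<and> m = m - length q + length q"
  proof (cases q)
    case Nil
    then show ?thesis using insert by (auto simp: is_partition_def)
  next
    case (Cons a q')
    then have "a + length q' < m" using q insert by auto
    then show ?thesis using q(1) Cons by (fastforce simp: is_partition_Cons)
  qed
  with q show ?case by (intro exI[of _ "(m - length q) # q"]) auto
qed

text \<open>The beads exceed the parts by a staircase of size
  \<open>length p * (length p - 1) / 2\<close>; doubling and rearranging avoids division and
  subtraction.\<close>

lemma sum_beads: "2 * sum_list (beads p) + length p = 2 * sum_list p + length p * length p"
  by (induction p) (auto simp: algebra_simps)

section \<open>Boxes as bead-gap pairs\<close>

text \<open>Since parts decrease, the rows that reach column \<open>j\<close> form an initial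
  segment of the indices, so membership amounts to comparison with its cardinality.\<close>

lemma part_ge_iff:
  assumes "is_partition p" "k \<in> {1..length p}"
  shows "j \<le> part p k \<longleftrightarrow> k \<le> conj_part p j"
proof -
  let ?S = "{k \<in> {1..length p}. part p k \<ge> j}"
  have anti: "part p b \<le> part p a" if "1 \<le> a" "a \<le> b" "b \<le> length p" for a b
    using assms(1) that
    by (cases "a = b") (auto simp: is_partition_def part_def sorted_wrt_iff_nth_less)
  show ?thesis
  proof
    assume "j \<le> part p k"
    then have "{1..k} \<subseteq> ?S" using assms(2) anti by (auto intro: le_trans)
    then have "card {1..k} \<le> card ?S" by (intro card_mono) auto
    then show "k \<le> conj_part p j" by (simp add: conj_part_def)
  next
    assume k: "k \<le> conj_part p j"
    show "j \<le> part p k"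
    proof (rule ccontr)
      assume n: "\<not> j \<le> part p k"
      have "?S \<subseteq> {1..<k}"
      proof
        fix x assume x: "x \<in> ?S"
        then show "x \<in> {1..<k}"
          using anti[of k x] assms(2) n by (cases "x < k") auto
      qed
      then have "card ?S \<le> card {1..<k}" by (intro card_mono) auto
      then show False using k assms(2) unfolding conj_part_def card_atLeastLessThan atLeastAtMost_iff
        by linarith
    qed
  qed
qed

lemma conj_part_le: "conj_part p j \<le> length p"
proof -
  have "card {k \<in> {1..length p}. part p k \<ge> j} \<le> card {1..length p}"
    by (intro card_mono) auto
  then show ?thesis by (simp add: conj_part_def)
qed

lemma conj_part_antimono: "j \<le> j' \<Longrightarrow> conj_part p j' \<le> conj_part p j"
  unfolding conj_part_def by (intro card_mono) auto

text \<open>Along the boundary of the diagram, read from the bottom left, beads are the positions of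
  vertical steps and gaps those of horizontal ones; this is the position of the step under column
  \<open>j\<close>.\<close>

definition column_gap :: "nat list \<Rightarrow> nat \<Rightarrow> nat" where
  "column_gap p j = j - 1 + (length p - conj_part p j)"

lemma hook_eq:
  assumes "(i, j) \<in> boxes p"
  shows "hook p (i, j) = int (beads p ! (i - 1)) - int (column_gap p j)"
  using assms conj_part_le[of p j]
  by (auto simp: hook_def boxes_def column_gap_def nth_beads part_def)

text \<open>The map increases strictly and lands in the gaps below the bead of row \<open>i\<close>.
  Counting gives surjectivity: of the \<open>part p i + (length p - i)\<close> positions below that
  bead, exactly the \<open>length p - i\<close> beads of later rows are occupied.\<close>

lemma row_bij:
  assumes p: "is_partition p" and i: "i \<in> {1..length p}"
  shows "bij_betw (column_gap p) {1..part p i}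
    {y. y < beads p ! (i - 1) \<and> y \<notin> set (beads p)}"
proof -
  let ?b = "beads p ! (i - 1)"
  let ?Y = "{y. y < ?b \<and> y \<notin> set (beads p)}"
  have b: "beads p ! (k - 1) = part p k + (length p - k)" if "k \<in> {1..length p}" for k
    using that by (auto simp: nth_beads part_def)
  have inj: "inj_on (column_gap p) {1..part p i}"
  proof (rule linorder_inj_onI)
    fix x y assume "x < y" "x \<in> {1..part p i}" "y \<in> {1..part p i}"
    then show "column_gap p x \<noteq> column_gap p y"
      using conj_part_antimono[of x y p] conj_part_le[of p x]
      by (auto simp: column_gap_def)
  qed auto
  have sub: "column_gap p ` {1..part p i} \<subseteq> ?Y"
  proof safe
    fix j assume j: "j \<in> {1..part p i}"
    then have "i \<le> conj_part p j" using part_ge_iff[OF p i] by auto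
    then show "column_gap p j < ?b"
      using j i b[OF i] conj_part_le[of p j] by (auto simp: column_gap_def)
  next
    fix j assume j: "j \<in> {1..part p i}" and "column_gap p j \<in> set (beads p)"
    then obtain k where k: "k \<in> {1..length p}" "column_gap p j = beads p ! (k - 1)"
      by (auto simp: in_set_conv_nth) (metis Suc_leI Suc_le_mono diff_Suc_1 le0 One_nat_def)
    \<comment> \<open>If column \<open>j\<close> meets row \<open>k\<close>, its gap lies strictly
      below the bead of row \<open>k\<close>, otherwise strictly above it.\<close>
    then show False
      using j b[OF k(1)] part_ge_iff[OF p k(1), of j] conj_part_le[of p j]
      by (cases "j \<le> part p k") (auto simp: column_gap_def)
  qed
  have less: "beads p ! k < beads p ! l \<longleftrightarrow> l < k" if "k < length p" "l < length p" for k l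
    using sorted_beads[OF p] that
    by (metis (no_types, lifting) length_beads linorder_neqE_nat not_less_iff_gr_or_eq
        sorted_wrt_iff_nth_less)
  have "?Y = {..<?b} - (\<lambda>k. beads p ! k) ` {i..<length p}"
    using less i by (auto simp: in_set_conv_nth)
  moreover have "(\<lambda>k. beads p ! k) ` {i..<length p} \<subseteq> {..<?b}"
    using less i by auto
  moreover have "card ((\<lambda>k. beads p ! k) ` {i..<length p}) = length p - i"
    using distinct_beads[OF p] by (subst card_image) (auto intro: inj_on_nth)
  ultimately have "card ?Y = part p i"
    using b[OF i] by (simp add: card_Diff_subset)
  then have "column_gap p ` {1..part p i} = ?Y"
    using sub inj by (intro card_subset_eq) (auto simp: card_image)
  with inj show ?thesis by (simp add: bij_betw_def)
qed

definition bead_gap_pairs :: "nat set \<Rightarrow> (nat \<times> nat) set" where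
  "bead_gap_pairs B = {(x, y). x \<in> B \<and> y \<notin> B \<and> y < x}"

text \<open>The bijections of the single rows glue together because distinct rows have distinct
  beads.\<close>

lemma boxes_bij:
  assumes p: "is_partition p"
  shows "bij_betw (\<lambda>(i, j). (beads p ! (i - 1), column_gap p j)) (boxes p)
    (bead_gap_pairs (set (beads p)))" (is "bij_betw ?f _ _")
proof -
  note row = row_bij[OF p, unfolded bij_betw_def]
  have "inj_on ?f (boxes p)"
  proof (rule inj_onI, clarify)
    fix i j i' j'
    assume *: "(i, j) \<in> boxes p" "(i', j') \<in> boxes p"
      "beads p ! (i - 1) = beads p ! (i' - 1)" "column_gap p j = column_gap p j'"
    then have "i - 1 = i' - 1"
      using nth_eq_iff_index_eq[OF distinct_beads[OF p], of "i - 1" "i' - 1"]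
      by (simp add: boxes_def) linarith
    with *(1,2) have "i = i'" by (auto simp: boxes_def)
    moreover have "inj_on (column_gap p) {1..part p i}"
      using row[of i] *(1) by (simp add: boxes_def)
    ultimately show "i = i' \<and> j = j'"
      using inj_onD *(1,2,4) by (fastforce simp: boxes_def)
  qed
  moreover have "?f ` boxes p = bead_gap_pairs (set (beads p))"
  proof (intro equalityI subsetI)
    fix z assume "z \<in> ?f ` boxes p"
    then show "z \<in> bead_gap_pairs (set (beads p))"
      using row by (fastforce simp: boxes_def bead_gap_pairs_def)
  next
    fix z assume "z \<in> bead_gap_pairs (set (beads p))"
    then obtain x y where z: "z = (x, y)" "x \<in> set (beads p)" "y \<notin> set (beads p)" "y < x"
      by (auto simp: bead_gap_pairs_def)
    then obtain k where k: "k < length p" "x = beads p ! k" by (auto simp: in_set_conv_nth)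
    then have "y \<in> column_gap p ` {1..part p (Suc k)}"
      using row[of "Suc k"] z by auto
    then obtain j where "j \<in> {1..part p (Suc k)}" "y = column_gap p j" by auto
    then have "(Suc k, j) \<in> boxes p" "?f (Suc k, j) = z"
      using k z by (auto simp: boxes_def)
    then show "z \<in> ?f ` boxes p" by (metis imageI)
  qed
  ultimately show ?thesis by (simp add: bij_betw_def)
qed

text \<open>A hook of length \<open>t\<close> is a bead \<open>b\<close> together with a gap
  \<open>b - t\<close>; positivity of \<open>t\<close> puts that gap strictly below the
  bead.\<close>

lemma t_cores_iff:
  assumes "t > 0"
  shows "p \<in> t_cores t \<longleftrightarrow>
    is_partition p \<and> (\<forall>b\<in>set (beads p). t \<le> b \<longrightarrow> b - t \<in> set (beads p))"
proof (cases "is_partition p")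
  case True
  let ?B = "set (beads p)"
  have "(\<forall>v\<in>boxes p. hook p v \<noteq> int t) \<longleftrightarrow>
    (\<forall>v\<in>boxes p. case (case v of (i, j) \<Rightarrow> (beads p ! (i - 1), column_gap p j)) of (x, y) \<Rightarrow> int x - int y \<noteq> int t)"
    by (intro ball_cong) (auto simp: hook_eq)
  also have "\<dots> \<longleftrightarrow> (\<forall>(x, y)\<in>bead_gap_pairs ?B. int x - int y \<noteq> int t)"
    unfolding bij_betw_imp_surj_on[OF boxes_bij[OF True], symmetric] by simp
  also have "\<dots> \<longleftrightarrow> (\<forall>b\<in>?B. t \<le> b \<longrightarrow> b - t \<in> ?B)"
  proof
    assume L: "\<forall>(x, y)\<in>bead_gap_pairs ?B. int x - int y \<noteq> int t"
    show "\<forall>b\<in>?B. t \<le> b \<longrightarrow> b - t \<in> ?B"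
    proof (intro ballI impI, rule ccontr)
      fix b assume "b \<in> ?B" "t \<le> b" "b - t \<notin> ?B"
      then have "(b, b - t) \<in> bead_gap_pairs ?B" using assms by (simp add: bead_gap_pairs_def)
      with L \<open>t \<le> b\<close> show False by fastforce
    qed
  next
    assume R: "\<forall>b\<in>?B. t \<le> b \<longrightarrow> b - t \<in> ?B"
    have "int x - int y \<noteq> int t" if "x \<in> ?B" "y \<notin> ?B" for x y
    proof
      assume "int x - int y = int t"
      then have "t \<le> x" "x - t = y" by auto
      with R that show False by blast
    qed
    then show "\<forall>(x, y)\<in>bead_gap_pairs ?B. int x - int y \<noteq> int t"
      by (auto simp: bead_gap_pairs_def)
  qed
  finally show ?thesis using True by (simp add: t_cores_def)
qed (simp add: t_cores_def)

section \<open>Abaci with beads pushed down on every runner\<close>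

text \<open>The abacus of James: runner \<open>r\<close> is the residue class of \<open>r\<close>,
  and its \<open>n r\<close> beads fill the lowest positions.\<close>

definition abacus :: "nat \<Rightarrow> (nat \<Rightarrow> nat) \<Rightarrow> nat set" where
  "abacus t n = {b. b div t < n (b mod t)}"

lemma abacus_bij:
  assumes "t > 0"
  shows "bij_betw (\<lambda>(r, k). r + t * k) (SIGMA r:{..<t}. {..<n r}) (abacus t n)"
  by (rule bij_betw_byWitness[where f' = "\<lambda>b. (b mod t, b div t)"])
    (use assms in \<open>auto simp: abacus_def\<close>)

lemma finite_abacus: "t > 0 \<Longrightarrow> finite (abacus t n)"
  using bij_betw_finite[OF abacus_bij[of t n]] by auto

lemma card_abacus: "t > 0 \<Longrightarrow> card (abacus t n) = (\<Sum>r<t. n r)"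
  using bij_betw_same_card[OF abacus_bij[of t n]] by simp

lemma sum_abacus:
  assumes "t > 0"
  shows "(\<Sum>b\<in>abacus t n. f b) = (\<Sum>r<t. \<Sum>k<n r. f (r + t * k))"
  using sum.reindex_bij_betw[OF abacus_bij[OF assms, of n], of f]
  by (simp add: sum.Sigma case_prod_unfold)

lemma prod_abacus_diff_runner:
  assumes "m < t"
  shows "(\<Prod>b\<in>{b \<in> abacus t n. b mod t \<noteq> m}. f b) = (\<Prod>r\<in>{..<t} - {m}. \<Prod>k<n r. f (r + t * k))"
proof -
  have "(\<Prod>r\<in>{..<t} - {m}. \<Prod>k<n r. f (r + t * k)) =
    (\<Prod>(r, k)\<in>(SIGMA r:{..<t} - {m}. {..<n r}). f (r + t * k))"
    by (simp add: prod.Sigma)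
  also have "\<dots> = (\<Prod>b\<in>{b \<in> abacus t n. b mod t \<noteq> m}. f b)"
    by (rule prod.reindex_bij_witness[where j = "\<lambda>(r, k). r + t * k" and i = "\<lambda>b. (b mod t, b div t)"])
      (use assms in \<open>auto simp: abacus_def\<close>)
  finally show ?thesis by simp
qed

lemma abacus_mem: "r < t \<Longrightarrow> r + t * k \<in> abacus t n \<longleftrightarrow> k < n r"
  by (auto simp: abacus_def)

lemma abacus_add_bead:
  assumes "m < t"
  shows "abacus t (n(m := Suc (n m))) = insert (m + t * n m) (abacus t n)"
proof (rule set_eqI)
  fix b
  have "b = m + t * n m \<longleftrightarrow> b mod t = m \<and> b div t = n m"
    using assms by (metis add.commute div_mult_self2 div_less mod_less mod_mult_self2 mult_div_mod_eq
        add_0_right bot_nat_0.extremum_strict)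
  then show "b \<in> abacus t (n(m := Suc (n m))) \<longleftrightarrow> b \<in> insert (m + t * n m) (abacus t n)"
    by (auto simp: abacus_def)
qed

definition level :: "nat \<Rightarrow> nat set \<Rightarrow> nat \<Rightarrow> nat" where
  "level t B r = (LEAST k. r + t * k \<notin> B)"

lemma level_abacus: "r < t \<Longrightarrow> level t (abacus t n) r = n r"
  unfolding level_def by (rule Least_equality) (auto simp: abacus_mem)

text \<open>A runner is infinite, so a finite \<open>B\<close> leaves a gap on it and the least one
  exists. Closure carries beads downwards, hence no bead lies above that gap.\<close>

lemma abacus_level:
  assumes t: "t > 0" and fin: "finite B" and closed: "\<forall>b\<in>B. t \<le> b \<longrightarrow> b - t \<in> B"
  shows "abacus t (level t B) = B"
proof (rule set_eqI)
  fix b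
  let ?r = "b mod t"
  have "inj (\<lambda>k. ?r + t * k)" using t by (auto simp: inj_on_def)
  then have "\<exists>k. ?r + t * k \<notin> B"
    using fin by (metis finite_subset image_subsetI finite_imageD infinite_UNIV_nat)
  then have level: "?r + t * level t B ?r \<notin> B" unfolding level_def by (rule LeastI_ex)
  have down: "?r + t * (k - i) \<in> B" if "?r + t * k \<in> B" "i \<le> k" for i k
    using that(2)
  proof (induction i)
    case (Suc i)
    then have "k - i = Suc (k - Suc i)" by simp
    then have "?r + t * (k - i) = ?r + t * (k - Suc i) + t" by (simp only: mult_Suc_right add.assoc add.commute)
    with Suc closed show ?case by (metis Suc_leD add_diff_cancel_right' le_add2)
  qed (use that in simp)
  show "b \<in> abacus t (level t B) \<longleftrightarrow> b \<in> B"
  proof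
    assume "b \<in> abacus t (level t B)"
    then have "?r + t * (b div t) \<in> B"
      using not_less_Least[of "b div t" "\<lambda>k. ?r + t * k \<notin> B"] by (auto simp: abacus_def level_def)
    then show "b \<in> B" by simp
  next
    assume b: "b \<in> B"
    show "b \<in> abacus t (level t B)"
    proof (rule ccontr)
      assume "b \<notin> abacus t (level t B)"
      then have "level t B ?r \<le> b div t" by (simp add: abacus_def)
      then show False using down[of "b div t" "b div t - level t B ?r"] b level by simp
    qed
  qed
qed

section \<open>The hook product when a bead is added\<close>

text \<open>The hook product transported along \<open>boxes_bij\<close>, for arbitrary sets, so that
  the induction on beads can do without partitions.\<close>

definition gap_prod :: "nat \<Rightarrow> nat set \<Rightarrow> real" where
  "gap_prod t B = (\<Prod>(x, y)\<in>bead_gap_pairs B. 1 - (real t)\<^sup>2 / (real x - real y)\<^sup>2)"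

lemma finite_bead_gap_pairs: "finite B \<Longrightarrow> finite (bead_gap_pairs B)"
proof (rule finite_subset)
  show "bead_gap_pairs B \<subseteq> (SIGMA x:B. {..<x})" by (auto simp: bead_gap_pairs_def)
qed auto

text \<open>Turning the gap \<open>z\<close> into a bead destroys its pairs with the beads above and
  creates pairs with the gaps below. The relation stays multiplied out because factors may
  vanish.\<close>

lemma gap_prod_insert:
  assumes fin: "finite B" and z: "z \<notin> B"
  shows "gap_prod t (insert z B) * (\<Prod>x\<in>{x \<in> B. z < x}. 1 - (real t)\<^sup>2 / (real z - real x)\<^sup>2) =
    gap_prod t B * (\<Prod>y\<in>{y. y < z \<and> y \<notin> B}. 1 - (real t)\<^sup>2 / (real z - real y)\<^sup>2)"
proof -
  define g where "g = (\<lambda>(x, y). 1 - (real t)\<^sup>2 / (real x - real y)\<^sup>2)"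
  define R where "R = {x \<in> B. z < x} \<times> {z}"
  define N where "N = {z} \<times> {y. y < z \<and> y \<notin> B}"
  have "bead_gap_pairs (insert z B) \<union> R = bead_gap_pairs B \<union> N"
    "bead_gap_pairs (insert z B) \<inter> R = {}" "bead_gap_pairs B \<inter> N = {}"
    using z by (auto simp: bead_gap_pairs_def R_def N_def)
  moreover have "finite R" "finite N" using fin by (auto simp: R_def N_def)
  ultimately have "prod g (bead_gap_pairs (insert z B)) * prod g R = prod g (bead_gap_pairs B) * prod g N"
    using fin by (metis finite_bead_gap_pairs finite_insert prod.union_disjoint)
  moreover have "prod g R = (\<Prod>x\<in>{x \<in> B. z < x}. 1 - (real t)\<^sup>2 / (real z - real x)\<^sup>2)"
    unfolding R_def g_def by (simp add: prod.cartesian_product[symmetric] power2_commute)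
  moreover have "prod g N = (\<Prod>y\<in>{y. y < z \<and> y \<notin> B}. 1 - (real t)\<^sup>2 / (real z - real y)\<^sup>2)"
    unfolding N_def g_def by (simp add: prod.cartesian_product[symmetric])
  ultimately show ?thesis by (simp add: gap_prod_def g_def)
qed

text \<open>With \<open>d = c - t * k\<close> each factor is \<open>(d - t) / d\<close> times
  \<open>(d + t) / d\<close>; both telescope, one leaving a factor at the start and one at the end
  of the runner. The condition on \<open>c\<close> keeps all denominators nonzero.\<close>

lemma runner_prod:
  fixes c :: real
  assumes t: "t > 0" and c: "\<And>k::int. c \<noteq> real t * of_int k"
  shows "(\<Prod>k<N. 1 - (real t)\<^sup>2 / (c - real t * real k)\<^sup>2) =
    (c + real t) / c * ((c - real t * real N) / (c - real t * real N + real t))"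
proof (induction N)
  case 0
  then show ?case using c[of 0] c[of "-1"] by simp
next
  case (Suc N)
  let ?d = "c - real t * real N"
  have nz: "c \<noteq> 0" "?d \<noteq> 0" "?d + real t \<noteq> 0" "?d - real t \<noteq> 0"
    using c[of 0] c[of "int N"] c[of "int N - 1"] c[of "int N + 1"] by (auto simp: algebra_simps)
  have *: "c - real t * real (Suc N) = ?d - real t" by (simp add: algebra_simps)
  have "(?d / (?d + real t)) * (1 - (real t)\<^sup>2 / ?d\<^sup>2) = (?d - real t) / ?d"
    using nz(2,3) by (simp add: divide_simps) (simp add: algebra_simps power2_eq_square)
  then show ?case unfolding prod.lessThan_Suc Suc.IH * by (simp only: mult.assoc) simp
qed

text \<open>Here \<open>- u\<close> is the residue of \<open>r - m\<close> and runs through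
  \<open>1, ..., t - 1\<close>. Numerators and denominators then agree up to \<open>t - 1\<close>
  signs, an even number. In \<open>gap_prod_add_bead\<close> this is the end contribution of the
  interval below the new bead.\<close>

lemma runner_constant:
  assumes "odd t" "m < t"
  shows "(\<Prod>r\<in>{..<t} - {m}. let u = real m - real r - (if r < m then real t else 0) in u / (u + real t)) = 1"
proof -
  have "(\<Prod>r\<in>{..<t} - {m}. let u = real m - real r - (if r < m then real t else 0) in u / (u + real t)) =
    (\<Prod>j\<in>{1..<t}. - real j / (real t - real j))"
    by (rule prod.reindex_bij_witness[where i = "\<lambda>j. if m + j < t then m + j else m + j - t"
          and j = "\<lambda>r. if r < m then r + t - m else r - m"])
      (use assms(2) in \<open>auto simp: Let_def of_nat_diff algebra_simps split: if_splits simp del: divide_minus_left\<close>)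
  also have "\<dots> = (-1) ^ (t - 1) * (\<Prod>j\<in>{1..<t}. real j) / (\<Prod>j\<in>{1..<t}. real t - real j)"
    by (simp add: prod_dividef prod_uminus)
  also have "(\<Prod>j\<in>{1..<t}. real t - real j) = (\<Prod>j\<in>{1..<t}. real j)"
    by (rule prod.reindex_bij_witness[where i = "\<lambda>j. t - j" and j = "\<lambda>j. t - j"])
      (auto simp: of_nat_diff)
  finally show ?thesis using assms(1) by simp
qed

text \<open>The required quotient has the gaps below \<open>z\<close> on top and the beads above
  \<open>z\<close> below. Multiplying both by the beads below \<open>z\<close> off runner
  \<open>m\<close> turns it into the interval \<open>{..<z}\<close> over \<open>B\<close>, both off
  runner \<open>m\<close>; these are abaci, so every runner telescopes.\<close>

lemma gap_prod_add_bead: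
  fixes n :: "nat \<Rightarrow> nat"
  assumes t: "odd t" and m: "m < t"
  defines "w \<equiv> \<lambda>r. real r + real t * real (n r)"
  shows "gap_prod t (abacus t (n(m := Suc (n m)))) =
    gap_prod t (abacus t n) * (\<Prod>r\<in>{..<t} - {m}. (w m - w r + real t) / (w m - w r))"
proof -
  define z where "z = m + t * n m"
  define B where "B = abacus t n"
  \<comment> \<open>The levels of the interval \<open>{..<z}\<close>: runners with
    \<open>r < m\<close> have one more position below \<open>z\<close>.\<close>
  define N where "N = (\<lambda>r. n m + (if r < m then 1 else 0))"
  define g where "g = (\<lambda>y. 1 - (real t)\<^sup>2 / (real z - real y)\<^sup>2)"
  have t0: "t > 0" using m by simp
  have wz: "w m = real z" by (simp add: w_def z_def)
  have zB: "z \<notin> B" using m by (simp add: z_def B_def abacus_mem)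
  have zmod: "z mod t = m" using m by (simp add: z_def)
  have fin: "finite B" using t0 by (simp add: B_def finite_abacus)
  have A: "abacus t N = {..<z}"
  proof (rule set_eqI)
    fix y
    have "y div t < n m + (if y mod t < m then 1 else 0) \<longleftrightarrow> y < z"
    proof -
      have y: "y = y mod t + t * (y div t)" by simp
      have ym: "y mod t < t" using t0 by simp
      consider "y div t < n m" | "y div t = n m" | "n m < y div t" by linarith
      then show ?thesis
      proof cases
        case 1
        then have "t * Suc (y div t) \<le> t * n m" by (intro mult_le_mono2) auto
        then show ?thesis using 1 y ym unfolding z_def mult_Suc_right by (simp, linarith)
      next
        case 2
        then show ?thesis using y by (simp add: z_def)
      next
        case 3
        then have "t * Suc (n m) \<le> t * (y div t)" by (intro mult_le_mono2) auto
        then show ?thesis using 3 y m unfolding z_def mult_Suc_right by (simp, linarith)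
      qed
    qed
    then show "y \<in> abacus t N \<longleftrightarrow> y \<in> {..<z}" by (simp add: abacus_def N_def)
  qed
  \<comment> \<open>Runner \<open>m\<close> is full below \<open>z\<close> and empty from
    \<open>z\<close> on, so it contains neither gaps below \<open>z\<close> nor beads above
    \<open>z\<close>.\<close>
  have runner: "y mod t = m \<Longrightarrow> y \<in> B \<longleftrightarrow> y < z" for y
  proof -
    assume ym: "y mod t = m"
    then have "y \<in> abacus t N \<longleftrightarrow> y \<in> B" by (simp add: abacus_def B_def N_def)
    with A show "y \<in> B \<longleftrightarrow> y < z" by simp
  qed
  let ?P1 = "{y. y < z \<and> y \<notin> B}" and ?P2 = "{y \<in> B. y < z \<and> y mod t \<noteq> m}" and ?P3 = "{x \<in> B. z < x}"
  have "{b \<in> abacus t N. b mod t \<noteq> m} = ?P1 \<union> ?P2" using runner by (auto simp: A)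
  moreover have "?P1 \<inter> ?P2 = {}" by auto
  ultimately have P12: "prod g {b \<in> abacus t N. b mod t \<noteq> m} = prod g ?P1 * prod g ?P2"
    using fin by (simp add: prod.union_disjoint)
  have "{b \<in> abacus t n. b mod t \<noteq> m} = ?P2 \<union> ?P3"
    using runner zB by (auto simp: B_def[symmetric] not_less_iff_gr_or_eq) 
  moreover have "?P2 \<inter> ?P3 = {}" by auto
  ultimately have P23: "prod g {b \<in> abacus t n. b mod t \<noteq> m} = prod g ?P2 * prod g ?P3"
    using fin by (simp add: prod.union_disjoint)
  \<comment> \<open>The factor vanishes only at distance \<open>t\<close> from \<open>z\<close>,
    hence on runner \<open>m\<close>; at \<open>y = z\<close> division by zero makes it
    \<open>1\<close>.\<close>
  have g0: "g y \<noteq> 0" if "y mod t \<noteq> m" for y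
  proof
    assume "g y = 0"
    then have "(real t)\<^sup>2 = (real z - real y)\<^sup>2"
      by (cases "real z = real y") (auto simp: g_def)
    then have "real z = real y + real t \<or> real y = real z + real t"
      by (auto simp: power2_eq_iff)
    then have "z = y + t \<or> y = z + t" by (metis of_nat_add of_nat_eq_iff)
    then show False using that zmod by auto
  qed
  have nz: "prod g ?P2 \<noteq> 0" "prod g ?P3 \<noteq> 0"
    using fin g0 runner by (auto simp: prod_zero_iff) (metis not_less_iff_gr_or_eq)
  let ?Q = "\<lambda>r. (w m - w r + real t) / (w m - w r)"
  let ?c = "\<lambda>r. real z - real r"
  have c: "?c r \<noteq> real t * of_int k" if "r \<in> {..<t} - {m}" for r and k :: int
  proof
    assume "?c r = real t * of_int k"
    then have "real_of_int (int z - int r) = real_of_int (int t * k)" by simp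
    then have "int z - int r = int t * k" by (simp only: of_int_eq_iff)
    then have "int z mod int t = int r mod int t" by (simp add: mod_eq_dvd_iff)
    then have "z mod t = r mod t" by (metis of_nat_mod of_nat_eq_iff)
    moreover have "r mod t = r" "r \<noteq> m" using that by auto
    ultimately show False using zmod by metis
  qed
  have row: "(\<Prod>k<M. g (r + t * k)) = (?c r + real t) / ?c r *
      ((?c r - real t * real M) / (?c r - real t * real M + real t))" if "r \<in> {..<t} - {m}" for r M
    using runner_prod[OF t0 c[OF that], of M] by (simp add: g_def algebra_simps)
  \<comment> \<open>On each runner the start factors for \<open>N r\<close> and \<open>n r\<close>
    coincide. The end factor for \<open>N r\<close> is the one in \<open>runner_constant\<close>,
    and the end factor for \<open>n r\<close> is the reciprocal of \<open>?Q r\<close>.\<close>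
  have "prod g {b \<in> abacus t N. b mod t \<noteq> m} =
    (\<Prod>r\<in>{..<t} - {m}. (\<Prod>k<n r. g (r + t * k)) *
      (?Q r * (let u = real m - real r - (if r < m then real t else 0) in u / (u + real t))))"
    unfolding prod_abacus_diff_runner[OF m]
  proof (rule prod.cong)
    fix r assume r: "r \<in> {..<t} - {m}"
    have e: "?c r - real t * real (N r) = real m - real r - (if r < m then real t else 0)"
      by (simp add: z_def N_def algebra_simps)
    have d: "?c r - real t * real (n r) = w m - w r" by (simp add: z_def w_def)
    have "w m - w r \<noteq> 0" "w m - w r + real t \<noteq> 0"
      using c[OF r, of "int (n r)"] c[OF r, of "int (n r) - 1"]
      by (auto simp: z_def w_def algebra_simps)
    then show "(\<Prod>k<N r. g (r + t * k)) = (\<Prod>k<n r. g (r + t * k)) *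
      (?Q r * (let u = real m - real r - (if r < m then real t else 0) in u / (u + real t)))"
      unfolding row[OF r] e d Let_def by simp
  qed simp
  also have "\<dots> = prod g {b \<in> abacus t n. b mod t \<noteq> m} * prod ?Q ({..<t} - {m})"
    unfolding prod.distrib runner_constant[OF t m] prod_abacus_diff_runner[OF m] by simp
  finally have "prod g ?P1 = prod g ?P3 * prod ?Q ({..<t} - {m})"
    unfolding P12 P23 using nz by simp
  moreover have "gap_prod t (insert z B) * prod g ?P3 = gap_prod t B * prod g ?P1"
    using gap_prod_insert[OF fin zB, of t] by (simp add: g_def)
  ultimately have "gap_prod t (insert z B) = gap_prod t B * prod ?Q ({..<t} - {m})"
    using nz by simp
  then show ?thesis using abacus_add_bead[OF m, of n] by (simp add: B_def z_def)
qed

section \<open>Vandermonde products\<close>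

definition vandermonde :: "nat \<Rightarrow> (nat \<Rightarrow> real) \<Rightarrow> real" where
  "vandermonde t a = (\<Prod>(i, j)\<in>{(i, j). i < j \<and> j < t}. a i - a j)"

lemma finite_pairs_less: "finite {(i, j). i < j \<and> j < (t::nat)}"
  by (rule finite_subset[of _ "{..<t} \<times> {..<t}"]) auto

lemma vandermonde_split_last:
  "vandermonde (Suc T) a = vandermonde T a * (\<Prod>i<T. a i - a T)"
proof -
  let ?N = "(\<lambda>i. (i, T)) ` {..<T}"
  have "{(i, j). i < j \<and> j < Suc T} = {(i, j). i < j \<and> j < T} \<union> ?N"
    by auto
  moreover have "{(i, j). i < j \<and> j < T} \<inter> ?N = {}" by auto
  moreover have "(\<Prod>(i, j)\<in>?N. a i - a j) = (\<Prod>i<T. a i - a T)"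
    by (subst prod.reindex) (auto simp: inj_on_def)
  ultimately show ?thesis
    unfolding vandermonde_def by (simp add: prod.union_disjoint finite_pairs_less)
qed

lemma vandermonde_split_first:
  "vandermonde (Suc T) a = vandermonde T (\<lambda>i. a (Suc i)) * (\<Prod>j<T. a 0 - a (Suc j))"
proof -
  let ?N = "(\<lambda>j. (0, Suc j)) ` {..<T}" and ?M = "map_prod Suc Suc ` {(i, j). i < j \<and> j < T}"
  have "{(i, j). i < j \<and> j < Suc T} = ?M \<union> ?N"
  proof (rule set_eqI, clarify)
    fix i j
    show "(i, j) \<in> {(i, j). i < j \<and> j < Suc T} \<longleftrightarrow> (i, j) \<in> ?M \<union> ?N"
      by (cases i; cases j) (auto simp: image_iff)
  qed
  moreover have "?M \<inter> ?N = {}" by auto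
  moreover have "(\<Prod>(i, j)\<in>?N. a i - a j) = (\<Prod>j<T. a 0 - a (Suc j))"
    by (subst prod.reindex) (auto simp: inj_on_def)
  moreover have "(\<Prod>(i, j)\<in>?M. a i - a j) = vandermonde T (\<lambda>i. a (Suc i))"
    unfolding vandermonde_def by (subst prod.reindex) (auto simp: inj_on_def case_prod_unfold)
  ultimately show ?thesis
    unfolding vandermonde_def by (simp add: prod.union_disjoint finite_pairs_less)
qed

lemma vandermonde_cong:
  "(\<And>i. i < t \<Longrightarrow> a i = b i) \<Longrightarrow> vandermonde t a = vandermonde t b"
  unfolding vandermonde_def by (rule prod.cong) auto

lemma vandermonde_shift: "vandermonde t (\<lambda>i. a i - c) = vandermonde t a"
  by (simp add: vandermonde_def)

text \<open>A cyclic shift of an odd number of entries is an even permutation.\<close>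

lemma vandermonde_rotate1:
  assumes "odd t"
  shows "vandermonde t (\<lambda>i. a (Suc i mod t)) = vandermonde t a"
proof -
  obtain T where T: "t = Suc T" "even T" using assms by (cases t) auto
  have "vandermonde t (\<lambda>i. a (Suc i mod t)) =
    vandermonde T (\<lambda>i. a (Suc i mod t)) * (\<Prod>i<T. a (Suc i mod t) - a (Suc T mod t))"
    unfolding T by (rule vandermonde_split_last)
  also have "vandermonde T (\<lambda>i. a (Suc i mod t)) = vandermonde T (\<lambda>i. a (Suc i))"
    by (rule vandermonde_cong) (simp add: T)
  also have "(\<Prod>i<T. a (Suc i mod t) - a (Suc T mod t)) = (\<Prod>i<T. - (a 0 - a (Suc i)))"
    by (rule prod.cong) (simp_all add: T)
  also have "\<dots> = (\<Prod>i<T. a 0 - a (Suc i))"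
    unfolding prod_uminus using T by simp
  finally show ?thesis unfolding T vandermonde_split_first .
qed

lemma vandermonde_rotate:
  assumes "odd t"
  shows "vandermonde t (\<lambda>i. a ((i + s) mod t)) = vandermonde t a"
proof (induction s)
  case 0
  show ?case by (rule vandermonde_cong) simp
next
  case (Suc s)
  have "vandermonde t (\<lambda>i. a ((i + Suc s) mod t)) = vandermonde t (\<lambda>i. a ((Suc i mod t + s) mod t))"
    by (rule vandermonde_cong) (simp add: mod_simps)
  also have "\<dots> = vandermonde t a"
    using vandermonde_rotate1[OF assms, of "\<lambda>i. a ((i + s) mod t)"] Suc.IH by simp
  finally show ?case .
qed

text \<open>This value at the empty abacus supplies the constant of the product formula. Splitting
  off the last entry \<open>T\<close> gives \<open>(-1) ^ T * fact T\<close>, so two consecutive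
  entries contribute a single sign.\<close>

lemma vandermonde_id:
  "vandermonde (2 * t' + 1) real = (-1) ^ t' * (\<Prod>k = 1..2 * t'. fact k)"
proof (induction t')
  case 0
  have "vandermonde (Suc 0) real = 1"
    unfolding vandermonde_split_last by (simp add: vandermonde_def)
  then show ?case by simp
next
  case (Suc t')
  have step: "(\<Prod>i<T. real i - real T) = (-1) ^ T * fact T" for T
  proof -
    have "(\<Prod>i<T. real i - real T) = (\<Prod>i<T. - (real T - real i))" by simp
    also have "\<dots> = (-1) ^ T * (\<Prod>i<T. real T - real i)" unfolding prod_uminus by simp
    also have "(\<Prod>i<T. real T - real i) = (\<Prod>i<T. real (Suc i))"
      by (rule prod.reindex_bij_witness[where i = "\<lambda>i. T - Suc i" and j = "\<lambda>i. T - Suc i"])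
        (auto simp: of_nat_diff)
    also have "\<dots> = fact T"
      by (simp add: fact_prod_Suc atLeast0LessThan)
    finally show ?thesis .
  qed
  have "2 * Suc t' + 1 = Suc (Suc (2 * t' + 1))" by simp
  then have "vandermonde (2 * Suc t' + 1) real =
      vandermonde (2 * t' + 1) real * ((-1) ^ (2 * t' + 1) * fact (2 * t' + 1)) *
      ((-1) ^ Suc (2 * t' + 1) * fact (Suc (2 * t' + 1)))"
    by (simp only: vandermonde_split_last step)
  also have "\<dots> = (-1) ^ Suc t' * ((\<Prod>k = 1..2 * t'. fact k) * fact (Suc (2 * t')) * fact (Suc (Suc (2 * t'))))"
    unfolding Suc.IH by (simp del: fact_Suc)
  also have "\<dots> = (-1) ^ Suc t' * (\<Prod>k = 1..2 * Suc t'. fact k)"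
    by (simp del: fact_Suc)
  finally show ?case .
qed

text \<open>Only pairs containing \<open>m\<close> change, and the quotient for such a pair does not
  depend on its orientation, as numerator and denominator flip sign together.\<close>

lemma vandermonde_update:
  assumes m: "m < t" and nz: "\<And>i j. i < t \<Longrightarrow> j < t \<Longrightarrow> i \<noteq> j \<Longrightarrow> a i \<noteq> a j"
  shows "vandermonde t (a(m := b)) = vandermonde t a * (\<Prod>r\<in>{..<t} - {m}. (b - a r) / (a m - a r))"
proof -
  let ?P = "{(i, j). i < j \<and> j < t}"
  let ?S = "{(i, j). i < j \<and> j < t \<and> (i = m \<or> j = m)}"
  define q where "q = (\<lambda>(i, j). ((a(m := b)) i - (a(m := b)) j) / (a i - a j))"
  have "(\<Prod>r\<in>{..<t} - {m}. (b - a r) / (a m - a r)) = prod q ?S"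
  proof (rule prod.reindex_bij_witness[where i = "\<lambda>(i, j). if i = m then j else i"
          and j = "\<lambda>r. (min r m, max r m)"])
    fix r assume "r \<in> {..<t} - {m}"
    then show "q (min r m, max r m) = (b - a r) / (a m - a r)"
      using minus_divide_divide[of "b - a r" "a m - a r"]
      by (auto simp: q_def min_def max_def)
  qed (use m in \<open>auto simp: min_def max_def split: if_splits\<close>)
  also have "\<dots> = prod q ?P"
  proof (rule prod.mono_neutral_left)
    show "\<forall>i\<in>?P - ?S. q i = 1" using nz by (fastforce simp: q_def)
  qed (auto simp: finite_pairs_less)
  finally have "vandermonde t a * (\<Prod>r\<in>{..<t} - {m}. (b - a r) / (a m - a r)) =
    (\<Prod>p\<in>?P. (case p of (i, j) \<Rightarrow> a i - a j) * q p)"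
    by (simp add: vandermonde_def prod.distrib)
  also have "\<dots> = vandermonde t (a(m := b))"
    unfolding vandermonde_def using nz by (intro prod.cong) (auto simp: q_def)
  finally show ?thesis ..
qed

section \<open>Product and sum formulas for abaci\<close>

text \<open>Induction on the number of beads, removing the top bead of some nonempty runner.
  Distinct residues keep the first gaps distinct, as \<open>vandermonde_update\<close>
  demands.\<close>

lemma gap_prod_abacus:
  assumes t: "odd t"
  shows "gap_prod t (abacus t n) * vandermonde t real = vandermonde t (\<lambda>r. real (r + t * n r))"
proof (induction "\<Sum>r<t. n r" arbitrary: n)
  case 0
  then have n: "n r = 0" if "r < t" for r using that by simp
  have "abacus t n = {}" using n odd_pos[OF t] by (auto simp: abacus_def)
  moreover have "vandermonde t (\<lambda>r. real (r + t * n r)) = vandermonde t real"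
    by (rule vandermonde_cong) (simp add: n)
  ultimately show ?case by (simp add: gap_prod_def bead_gap_pairs_def)
next
  case (Suc N)
  then have "(\<Sum>r<t. n r) \<noteq> 0" by linarith
  then obtain m where m: "m < t" "n m \<noteq> 0" by (auto simp: sum_eq_0_iff)
  define n' where "n' = n(m := n m - 1)"
  have n: "n = n'(m := Suc (n' m))" using m by (auto simp: n'_def)
  have "(\<Sum>r<t. n r) = Suc (\<Sum>r<t. n' r)"
    using m by (simp add: n sum.remove[of "{..<t}" m])
  then have IH: "gap_prod t (abacus t n') * vandermonde t real = vandermonde t (\<lambda>r. real (r + t * n' r))"
    using Suc by simp
  let ?w = "\<lambda>r. real (r + t * n' r)"
  have inj: "?w i \<noteq> ?w j" if "i < t" "j < t" "i \<noteq> j" for i j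
  proof
    assume "?w i = ?w j"
    then have "(i + t * n' i) mod t = (j + t * n' j) mod t" by (metis of_nat_eq_iff)
    with that show False by simp
  qed
  have "(\<lambda>r. real (r + t * n r)) = ?w(m := ?w m + real t)"
    by (auto simp: n algebra_simps)
  then have "vandermonde t (\<lambda>r. real (r + t * n r)) =
    vandermonde t ?w * (\<Prod>r\<in>{..<t} - {m}. (?w m + real t - ?w r) / (?w m - ?w r))"
    using vandermonde_update[of m t ?w, OF m(1) inj] by simp
  also have "\<dots> = gap_prod t (abacus t n') *
      (\<Prod>r\<in>{..<t} - {m}. (?w m - ?w r + real t) / (?w m - ?w r)) * vandermonde t real"
    unfolding IH[symmetric] by (simp add: algebra_simps)
  also have "\<dots> = gap_prod t (abacus t n) * vandermonde t real"
    using gap_prod_add_bead[OF t m(1), of n'] by (simp flip: n)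
  finally show ?case ..
qed

text \<open>For a bead \<open>x\<close> one has \<open>2 * t * x = (x + t)^2 - x^2 - t^2\<close>,
  and the squares telescope along each runner.\<close>

lemma sum_abacus_id:
  assumes "t > 0"
  shows "2 * real t * (\<Sum>b\<in>abacus t n. real b) =
    (\<Sum>r<t. (real (r + t * n r))\<^sup>2) - (\<Sum>r<t. (real r)\<^sup>2) - (real t)\<^sup>2 * (\<Sum>r<t. real (n r))"
proof -
  have "2 * real t * (\<Sum>k<N. real (r + t * k)) = (real (r + t * N))\<^sup>2 - (real r)\<^sup>2 - (real t)\<^sup>2 * real N"
    for r N by (induction N) (auto simp: algebra_simps power2_eq_square)
  then show ?thesis
    unfolding sum_abacus[OF assms] sum_distrib_left by (simp flip: sum_subtractf add: sum_distrib_left)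
qed

lemma sum_mod_shift:
  fixes g :: "nat \<Rightarrow> 'a::comm_monoid_add"
  assumes "t > 0"
  shows "(\<Sum>i<t. g ((i + s) mod t)) = (\<Sum>i<t. g i)"
proof -
  have "inj_on (\<lambda>i. (i + s) mod t) {..<t}"
  proof (rule inj_onI)
    fix i j assume "i \<in> {..<t}" "j \<in> {..<t}" "(i + s) mod t = (j + s) mod t"
    then show "i = j" using cong_add_rcancel_nat[of i s j t] by (auto simp: cong_def)
  qed
  moreover have "(\<lambda>i. (i + s) mod t) ` {..<t} \<subseteq> {..<t}" using assms by auto
  ultimately have "bij_betw (\<lambda>i. (i + s) mod t) {..<t} {..<t}"
    by (simp add: bij_betw_def endo_inj_surj)
  then show ?thesis by (rule sum.reindex_bij_betw)
qed

section \<open>The coding and its bijectivity\<close>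

definition first_gap :: "nat \<Rightarrow> nat list \<Rightarrow> nat \<Rightarrow> nat" where
  "first_gap t p r = r + t * level t (set (beads p)) r"

text \<open>Subtracting \<open>length p\<close> makes the first gaps independent of the number of beads;
  subtracting also \<open>(t - 1) div 2\<close> makes their sum vanish.\<close>

definition coding :: "nat \<Rightarrow> nat list \<Rightarrow> int list" where
  "coding t p = (let s = (t - 1) div 2 + length p in
    map (\<lambda>i. int (first_gap t p ((i + s) mod t)) - int s) [0..<t])"

lemma length_coding [simp]: "length (coding t p) = t"
  by (simp add: coding_def Let_def)

context
  fixes t t' :: nat
  assumes t: "t = 2 * t' + 1"
begin

lemma t_pos: "t > 0" and t_half: "(t - 1) div 2 = t'" and t_odd: "odd t"
  using t by auto

lemma nth_coding:
  "i < t \<Longrightarrow> coding t p ! i =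
    int (first_gap t p ((i + (t' + length p)) mod t)) - int (t' + length p)"
  unfolding coding_def t_half by (simp add: Let_def)

lemma sum_first: "(\<Sum>r<t. int r) = int t * int t'"
proof -
  have "(\<Sum>r<2 * k + 1. int r) = int (2 * k + 1) * int k" for k
    by (induction k) (auto simp: algebra_simps)
  then show ?thesis by (simp add: t)
qed

lemma abacus_core:
  assumes "p \<in> t_cores t"
  shows "abacus t (level t (set (beads p))) = set (beads p)"
  using assms t_pos by (intro abacus_level) (auto simp: t_cores_iff)

lemma sum_level:
  assumes "p \<in> t_cores t"
  shows "(\<Sum>r<t. level t (set (beads p)) r) = length p"
  using card_abacus[OF t_pos, of "level t (set (beads p))"] assms
  by (simp add: abacus_core card_beads t_cores_def)

text \<open>The residues have mean \<open>t'\<close>, and the levels add up to the number of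
  beads.\<close>

lemma sum_first_gap:
  assumes "p \<in> t_cores t"
  shows "(\<Sum>r<t. int (first_gap t p r)) = int t * int (t' + length p)"
proof -
  have "(\<Sum>r<t. int (first_gap t p r)) = int t * int t' + int t * int (\<Sum>r<t. level t (set (beads p)) r)"
    by (simp add: first_gap_def sum.distrib sum_first sum_distrib_left)
  then show ?thesis unfolding sum_level[OF assms] by (simp add: algebra_simps)
qed

text \<open>Entry \<open>i\<close> is read from the runner of \<open>i + s\<close>, so subtracting
  \<open>s\<close> restores the residue \<open>i\<close>; and \<open>s\<close> is the mean of the
  first gaps.\<close>

lemma coding_in_V_codings:
  assumes "p \<in> t_cores t"
  shows "coding t p \<in> V_codings t"
proof -
  let ?s = "t' + length p"
  have "[coding t p ! i = int i] (mod int t)" if "i < t" for i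
  proof -
    have "int (first_gap t p ((i + ?s) mod t)) mod int t = int (i + ?s) mod int t"
      by (simp add: first_gap_def flip: of_nat_mod of_nat_mult of_nat_add)
    then have "(int (first_gap t p ((i + ?s) mod t)) - int ?s) mod int t = (int (i + ?s) - int ?s) mod int t"
      by (rule mod_diff_cong) simp
    then show ?thesis using that by (simp add: nth_coding cong_def)
  qed
  moreover have "(\<Sum>i<t. coding t p ! i) = 0"
  proof -
    have "(\<Sum>i<t. coding t p ! i) = (\<Sum>i<t. int (first_gap t p ((i + ?s) mod t))) - int t * int ?s"
      by (simp add: nth_coding sum_subtractf)
    also have "\<dots> = 0"
      using sum_mod_shift[OF t_pos, of "\<lambda>r. int (first_gap t p r)" ?s] sum_first_gap[OF assms] by simp
    finally show ?thesis .
  qed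
  ultimately show ?thesis by (simp add: V_codings_def)
qed

lemma shift_surj:
  assumes "r < t"
  obtains i where "i < t" "(i + s) mod t = r"
proof
  \<comment> \<open>This is \<open>r - s\<close> modulo \<open>t\<close>, with
    \<open>t - s mod t\<close> in place of \<open>- s\<close> to stay in the naturals.\<close>
  let ?i = "(r + (t - s mod t)) mod t"
  show "?i < t" using t_pos by simp
  have "s mod t \<le> t" using t_pos by (simp add: less_imp_le)
  have "(?i + s) mod t = (r + (t - s mod t) + s mod t) mod t" by (simp add: mod_simps)
  also have "r + (t - s mod t) + s mod t = r + t" using \<open>s mod t \<le> t\<close> by simp
  also have "(r + t) mod t = r" using assms by simp
  finally show "(?i + s) mod t = r" .
qed

text \<open>As \<open>0\<close> is not a bead, the smallest first gap is \<open>0\<close>; so the coding determines the length.\<close>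

lemma Min_coding:
  assumes p: "p \<in> t_cores t"
  shows "Min (set (coding t p)) = - int (t' + length p)"
proof (rule Min_eqI)
  fix y assume "y \<in> set (coding t p)"
  then show "- int (t' + length p) \<le> y"
    unfolding coding_def t_half by (auto simp: Let_def)
next
  have "0 \<notin> set (beads p)" using p by (simp add: zero_notin_beads t_cores_def)
  then have "first_gap t p 0 = 0"
    by (simp add: first_gap_def level_def Least_equality)
  moreover obtain i where "i < t" "(i + (t' + length p)) mod t = 0"
    using shift_surj[OF t_pos] by blast
  ultimately show "- int (t' + length p) \<in> set (coding t p)"
    unfolding coding_def t_half by (auto simp: Let_def image_iff intro!: bexI[of _ i])
qed simp

text \<open>The minimum reveals the length and thereby the shift; then each entry gives the level of
  one runner, and the levels determine the bead set.\<close>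

lemma inj_coding: "inj_on (coding t) (t_cores t)"
proof (rule inj_onI)
  fix p q assume p: "p \<in> t_cores t" and q: "q \<in> t_cores t" and eq: "coding t p = coding t q"
  have len: "length p = length q" using Min_coding[OF p] Min_coding[OF q] eq by simp
  have lev: "level t (set (beads p)) r = level t (set (beads q)) r" if r: "r < t" for r
  proof -
    obtain i where i: "i < t" "(i + (t' + length p)) mod t = r" using shift_surj[OF r, of "t' + length p"] by blast
    have "int (first_gap t p r) = int (first_gap t q r)"
      using nth_coding[OF i(1), of p] nth_coding[OF i(1), of q] eq i(2) by (simp add: len)
    then show ?thesis using t_pos by (simp add: first_gap_def)
  qed
  have "abacus t (level t (set (beads p))) = abacus t (level t (set (beads q)))"
    using lev t_pos by (simp add: abacus_def)
  then have "set (beads p) = set (beads q)" by (simp add: abacus_core p q)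
  then show "p = q" using p q by (intro beads_set_inj) (auto simp: t_cores_def)
qed

lemma surj_coding:
  assumes v: "v \<in> V_codings t"
  shows "v \<in> coding t ` t_cores t"
proof -
  have len: "length v = t" and res: "\<And>i. i < t \<Longrightarrow> v ! i mod int t = int i"
    and sum0: "(\<Sum>i<t. v ! i) = 0"
    using v by (auto simp: V_codings_def cong_def simp flip: of_nat_mod)
  define M where "M = Min (set v)"
  \<comment> \<open>By \<open>Min_coding\<close> the shift has to be \<open>- M\<close>, so runner
    \<open>r\<close> corresponds to the entry with index \<open>r + M\<close> modulo
    \<open>t\<close>; \<open>u\<close> is this offset made nonnegative.\<close>
  define u where "u = nat (M mod int t)"
  define n where "n r = nat ((v ! ((r + u) mod t) - M) div int t)" for r
  have u: "int u = M mod int t" using t_pos by (simp add: u_def)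
  have n: "int r + int t * int (n r) = v ! ((r + u) mod t) - M" if "r < t" for r
  proof -
    let ?w = "v ! ((r + u) mod t) - M"
    have "?w mod int t = (int ((r + u) mod t) - M) mod int t"
      using res[of "(r + u) mod t"] t_pos by (metis mod_diff_left_eq mod_less_divisor)
    also have "\<dots> = (int r + (int u - M)) mod int t"
      by (simp add: of_nat_mod mod_diff_left_eq algebra_simps)
    also have "\<dots> = int r"
      using that mod_add_right_eq[of "int r" "int u - M" "int t"] by (simp add: u mod_diff_left_eq)
    finally have "?w mod int t = int r" .
    moreover have "?w \<ge> 0" using t_pos len by (simp add: M_def)
    ultimately show ?thesis
      unfolding n_def using t_pos by (simp add: pos_imp_zdiv_nonneg_iff) (metis mod_mult_div_eq)
  qed
  \<comment> \<open>The minimal entry has index \<open>u\<close> and so belongs to runner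
    \<open>0\<close>. Thus \<open>0\<close> is not a bead, and the abacus is the bead set of a
    partition.\<close>
  have "n 0 = 0"
  proof -
    have "M \<in> set v" unfolding M_def using len t_pos by (intro Min_in) auto
    then obtain j where j: "j < t" "v ! j = M" using len by (auto simp: in_set_conv_nth)
    then have "(0 + u) mod t = j" using res[of j] u t_pos by (metis add_0 mod_less nat_int of_nat_mod u_def)
    then show ?thesis using n[of 0] t_pos j by simp
  qed
  then have "0 \<notin> abacus t n" by (simp add: abacus_def)
  then obtain p where p: "is_partition p" "set (beads p) = abacus t n"
    using ex_partition_beads[OF finite_abacus[OF t_pos]] by blast
  have core: "p \<in> t_cores t"
    unfolding t_cores_iff[OF t_pos] using p t_pos
    by (auto simp: abacus_def le_mod_geq[symmetric] le_div_geq)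
  have level: "level t (set (beads p)) r = n r" if "r < t" for r
    using that by (simp add: p level_abacus)
  \<comment> \<open>The length was not prescribed; computing the sum of the first gaps in two ways
    shows that the shift used by \<open>coding\<close> is indeed \<open>- M\<close>.\<close>
  have "int t * int (t' + length p) = (\<Sum>r<t. int r + int t * int (n r))"
    using sum_first_gap[OF core] by (simp add: first_gap_def level)
  also have "\<dots> = (\<Sum>r<t. v ! ((r + u) mod t)) - int t * M"
    by (simp add: n sum_subtractf)
  also have "\<dots> = - int t * M"
    using sum_mod_shift[OF t_pos, of "\<lambda>i. v ! i" u] sum0 by simp
  finally have M: "int (t' + length p) = - M"
    using t_pos by (metis mult_cancel_left mult_minus_left mult_minus_right of_nat_0_less_iff less_irrefl)
  have "coding t p = v"
  proof (rule nth_equalityI)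
    fix i assume "i < length (coding t p)"
    then have i: "i < t" by simp
    let ?r = "(i + (t' + length p)) mod t"
    have "int ((?r + u) mod t) = (int i + int (t' + length p) + int u) mod int t"
      by (simp add: of_nat_mod mod_simps)
    also have "\<dots> = int i" using i unfolding M u by (simp add: mod_simps flip: of_nat_mod)
    finally have r: "(?r + u) mod t = i" by simp
    have "coding t p ! i = int ?r + int t * int (n ?r) + M"
      using i M t_pos by (simp add: nth_coding first_gap_def level)
    also have "\<dots> = v ! i" using n[of ?r] t_pos by (simp add: r)
    finally show "coding t p ! i = v ! i" .
  qed (simp add: len)
  with core show ?thesis by blast
qed

section \<open>Size and hook product in terms of the coding\<close>

text \<open>The coding is the vector of first gaps centred at their mean \<open>?s\<close>, so its
  square sum is that of the first gaps minus \<open>t * ?s^2\<close>; \<open>sum_abacus_id\<close>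
  and \<open>sum_beads\<close> relate the latter square sum to the size.\<close>

lemma coding_size:
  assumes p: "p \<in> t_cores t"
  shows "real (sum_list p) =
    1 / (2 * real t) * (\<Sum>i<t. (real_of_int (coding t p ! i))\<^sup>2) - ((real t)\<^sup>2 - 1) / 24"
proof -
  let ?s = "real (t' + length p)" and ?w = "\<lambda>r. real (first_gap t p r)"
  have part: "is_partition p" using p by (simp add: t_cores_def)
  have "(\<Sum>i<t. (real_of_int (coding t p ! i))\<^sup>2) = (\<Sum>i<t. (?w ((i + (t' + length p)) mod t) - ?s)\<^sup>2)"
    by (simp add: nth_coding)
  also have "\<dots> = (\<Sum>r<t. (?w r - ?s)\<^sup>2)"
    by (rule sum_mod_shift[OF t_pos, of "\<lambda>r. (?w r - ?s)\<^sup>2"])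
  also have "\<dots> = (\<Sum>r<t. (?w r)\<^sup>2) - 2 * ?s * (\<Sum>r<t. ?w r) + real t * ?s\<^sup>2"
    by (simp add: power2_diff sum.distrib sum_subtractf sum_distrib_left algebra_simps)
  also have "(\<Sum>r<t. ?w r) = real t * ?s"
    using arg_cong[OF sum_first_gap[OF p], of real_of_int] by simp
  finally have v: "(\<Sum>i<t. (real_of_int (coding t p ! i))\<^sup>2) = (\<Sum>r<t. (?w r)\<^sup>2) - real t * ?s\<^sup>2"
    by (simp add: power2_eq_square algebra_simps)
  have "sum_list (beads p) = \<Sum> (set (beads p))"
    using distinct_beads[OF part] using sum_list_distinct_conv_sum_set[of "beads p" "\<lambda>b. b"] by simp
  then have b: "(\<Sum>b\<in>set (beads p). real b) = real (sum_list (beads p))" by simp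
  have "real (2 * sum_list (beads p) + length p) = real (2 * sum_list p + length p * length p)"
    by (simp only: sum_beads)
  then have size: "2 * real (sum_list p) = 2 * real (sum_list (beads p)) + real (length p) - (real (length p))\<^sup>2"
    by (simp add: power2_eq_square)
  have lev: "(\<Sum>r<t. real (level t (set (beads p)) r)) = real (length p)"
    using arg_cong[OF sum_level[OF p], of real] by simp
  have sq: "6 * (\<Sum>r<t. (real r)\<^sup>2) = real t * (real t - 1) * (2 * real t - 1)"
    by (induction t) (auto simp: algebra_simps power2_eq_square)
  have main: "2 * real t * real (sum_list (beads p)) =
      (\<Sum>r<t. (?w r)\<^sup>2) - (\<Sum>r<t. (real r)\<^sup>2) - (real t)\<^sup>2 * real (length p)"
    using sum_abacus_id[OF t_pos, of "level t (set (beads p))"]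
    by (simp add: abacus_core[OF p] b lev first_gap_def)
  have tt: "real t' = (real t - 1) / 2" by (simp add: t)
  have "24 * real t * real (sum_list p) =
      12 * (\<Sum>i<t. (real_of_int (coding t p ! i))\<^sup>2) - real t * ((real t)\<^sup>2 - 1)"
  proof -
    have "24 * real t * real (sum_list p) = 12 * real t * (2 * real (sum_list p))" by simp
    also have "\<dots> = 12 * (2 * real t * real (sum_list (beads p))) +
        12 * real t * (real (length p) - (real (length p))\<^sup>2)"
      unfolding size by (simp add: algebra_simps)
    also have "\<dots> = 12 * (\<Sum>r<t. (?w r)\<^sup>2) - 2 * (6 * (\<Sum>r<t. (real r)\<^sup>2)) -
        12 * (real t)\<^sup>2 * real (length p) + 12 * real t * (real (length p) - (real (length p))\<^sup>2)"
      unfolding main by (simp add: algebra_simps)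
    \<comment> \<open>All terms in \<open>length p\<close> cancel because
      \<open>2 * t' = t - 1\<close>; the constant left is \<open>12 * t * t'^2 - 2 * t * (t - 1) *
      (2 * t - 1) = - t * (t^2 - 1)\<close>.\<close>
    also have "\<dots> = 12 * ((\<Sum>r<t. (?w r)\<^sup>2) - real t * ?s\<^sup>2) - real t * ((real t)\<^sup>2 - 1)"
      unfolding sq by (simp add: tt field_simps power2_eq_square)
    finally show ?thesis unfolding v .
  qed
  then show ?thesis using t_pos by (simp add: field_simps)
qed

text \<open>Translation and, for odd \<open>t\<close>, cyclic rotation leave the Vandermonde product
  unchanged, so the coding may be replaced by the first gaps, to which
  \<open>gap_prod_abacus\<close> applies.\<close>

lemma coding_product:
  assumes p: "p \<in> t_cores t"
  shows "(\<Prod>b\<in>boxes p. 1 - (real t)\<^sup>2 / (real_of_int (hook p b))\<^sup>2) =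
    (-1) ^ t' / (\<Prod>k = 1..t - 1. fact k) *
    (\<Prod>(i, j)\<in>{(i, j). i < j \<and> j < t}. real_of_int (coding t p ! i) - real_of_int (coding t p ! j))"
proof -
  let ?B = "set (beads p)" and ?w = "\<lambda>r. real (first_gap t p r)"
  have part: "is_partition p" using p by (simp add: t_cores_def)
  have "(\<Prod>b\<in>boxes p. 1 - (real t)\<^sup>2 / (real_of_int (hook p b))\<^sup>2) =
    (\<Prod>b\<in>boxes p. case (case b of (i, j) \<Rightarrow> (beads p ! (i - 1), column_gap p j)) of
      (x, y) \<Rightarrow> 1 - (real t)\<^sup>2 / (real x - real y)\<^sup>2)"
    by (rule prod.cong) (auto simp: hook_eq)
  also have "\<dots> = gap_prod t ?B"
    unfolding gap_prod_def by (rule prod.reindex_bij_betw[OF boxes_bij[OF part]])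
  finally have L: "(\<Prod>b\<in>boxes p. 1 - (real t)\<^sup>2 / (real_of_int (hook p b))\<^sup>2) = gap_prod t ?B" .
  have "(\<Prod>(i, j)\<in>{(i, j). i < j \<and> j < t}. real_of_int (coding t p ! i) - real_of_int (coding t p ! j)) =
      vandermonde t (\<lambda>i. real_of_int (coding t p ! i))"
    by (simp add: vandermonde_def)
  also have "\<dots> = vandermonde t (\<lambda>i. ?w ((i + (t' + length p)) mod t) - real (t' + length p))"
    by (rule vandermonde_cong) (simp add: nth_coding)
  also have "\<dots> = vandermonde t ?w"
    unfolding vandermonde_shift by (rule vandermonde_rotate[OF t_odd])
  also have "\<dots> = gap_prod t ?B * vandermonde t real"
    using gap_prod_abacus[OF t_odd, of "level t ?B"]
    by (simp add: abacus_core[OF p] first_gap_def)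
  finally have R: "(\<Prod>(i, j)\<in>{(i, j). i < j \<and> j < t}. real_of_int (coding t p ! i) - real_of_int (coding t p ! j)) =
      gap_prod t ?B * vandermonde t real" .
  have V: "vandermonde t real = (-1) ^ t' * (\<Prod>k = 1..t - 1. fact k)"
    using vandermonde_id[of t'] by (simp add: t)
  have "(\<Prod>k = 1..t - 1. fact k :: real) \<noteq> 0" by simp
  \<comment> \<open>The sign \<open>(-1) ^ t'\<close> is its own inverse, so it may stand in the
    numerator.\<close>
  then show ?thesis unfolding L R V by (simp add: field_simps flip: power_mult_distrib)
qed

end

theorem theorem5p1:
  fixes t t' :: nat
  assumes "t = 2 * t' + 1"
  shows "\<exists>\<phi> :: nat list \<Rightarrow> int list.
    bij_betw \<phi> (t_cores t) (V_codings t) \<and>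
    (\<forall>p\<in>t_cores t.
      real (sum_list p) =
        1 / (2 * real t) * (\<Sum>i<t. (real_of_int (\<phi> p ! i))\<^sup>2) - ((real t)\<^sup>2 - 1) / 24 \<and>
      (\<Prod>b\<in>boxes p. 1 - (real t)\<^sup>2 / (real_of_int (hook p b))\<^sup>2) =
        (-1) ^ t' / (\<Prod>k = 1..t - 1. fact k) *
        (\<Prod>(i, j)\<in>{(i, j). i < j \<and> j < t}. real_of_int (\<phi> p ! i) - real_of_int (\<phi> p ! j)))"
proof (intro exI conjI ballI)
  show "bij_betw (coding t) (t_cores t) (V_codings t)"
    using inj_coding[OF assms] coding_in_V_codings[OF assms] surj_coding[OF assms]
    by (auto simp: bij_betw_def)
qed (rule coding_size[OF assms] coding_product[OF assms], assumption)+

end
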